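(* For positive integers $n$ and $r$, let $s=(2r,3r,\ldots,nr)$ and $\mu=(r,2r,\ldots,nr)$. Then \[ d_{n-1}^s(z)+d_n^\mu(z)=d_{n,r}(z). \]
   Context: For a sequence $t=(t_1,\ldots,t_m)$ of positive integers, $P_m^t=\{x\in\mathbb{R}^m:0\le x_1/t_1\le\cdots\le x_m/t_m\le1\}$ (for $m=0$ a point) and $d_m^t(z)=\ell^\ast(P_m^t;z)$, where for a lattice $d$-simplex $\Delta=\mathrm{conv}(v^{(0)},\ldots,v^{(d)})\subset\mathbb{R}^m$, $\ell^\ast(\Delta;z)=\sum_{x\in\Pi^\circ_\Delta\cap\mathbb{Z}^{m+1}}z^{x_{m+1}}$, $\Pi^\circ_\Delta=\{\sum_i\lambda_i(v^{(i)},1):0<\lambda_i<1\}$. An $r$-colored permutation is $(\pi,c)$ with $\pi\in\mathfrak{S}_n$, $c\in\{0,\ldots,r-1\}^n$. An index $i$ is an excedance if $\pi_i>i$, or $\pi_i=i$ and $c_i>0$. A derangement is one with no fixed point of color $0$; $d_{n,r}(z)=\sum_{\sigma}z^{\mathrm{exc}(\sigma)}$ over all $r$-colored derangements of length $n$. *)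

theory Defs
  imports "HOL-Computational_Algebra.Polynomial" "HOL-Combinatorics.Permutations"
begin

text \<open>Points of R^m are represented as functions nat => real whose coordinates
  with index >= m vanish; coordinate i (0-based) is x_(i+1) of the paper.
  A sequence t = (t_1,...,t_m) is a list of naturals, t ! i = t_(i+1).\<close>

definition Pt :: "nat list \<Rightarrow> (nat \<Rightarrow> real) set" where
  "Pt t = {x. (\<forall>i\<ge>length t. x i = 0) \<and>
     (let m = length t; q = (\<lambda>i. x i / real (t ! i)) in
        (m > 0 \<longrightarrow> 0 \<le> q 0 \<and> q (m - 1) \<le> 1) \<and>
        (\<forall>i. i + 1 < m \<longrightarrow> q i \<le> q (i + 1)))}"

definition vertices :: "(nat \<Rightarrow> real) set \<Rightarrow> (nat \<Rightarrow> real) set" where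
  "vertices S = {x \<in> S. \<not> (\<exists>a\<in>S. \<exists>b\<in>S. a \<noteq> b \<and> x = (\<lambda>i. (a i + b i) / 2))}"

text \<open>Lattice points (x, h) of the open fundamental parallelepiped of the cone
  over the simplex with vertex set V, lifted to height 1: x in Z^m, h the last coordinate.\<close>
definition open_par_lattice :: "nat \<Rightarrow> (nat \<Rightarrow> real) set \<Rightarrow> ((nat \<Rightarrow> int) \<times> int) set" where
  "open_par_lattice m V = {(y, h). (\<forall>i\<ge>m. y i = 0) \<and>
     (\<exists>lam::(nat \<Rightarrow> real) \<Rightarrow> real. (\<forall>v\<in>V. 0 < lam v \<and> lam v < 1) \<and>
          (\<forall>i. real_of_int (y i) = (\<Sum>v\<in>V. lam v * v i)) \<and>
          real_of_int h = (\<Sum>v\<in>V. lam v))}"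

definition ell_star :: "nat \<Rightarrow> (nat \<Rightarrow> real) set \<Rightarrow> int poly" where
  "ell_star m \<Delta> = (\<Sum>p\<in>open_par_lattice m (vertices \<Delta>). monom 1 (nat (snd p)))"

definition d_t :: "nat list \<Rightarrow> int poly" where
  "d_t t = ell_star (length t) (Pt t)"

definition colored_perms :: "nat \<Rightarrow> nat \<Rightarrow> ((nat \<Rightarrow> nat) \<times> (nat \<Rightarrow> nat)) set" where
  "colored_perms n r = {(\<pi>, c). \<pi> permutes {1..n} \<and>
      (\<forall>i\<in>{1..n}. c i < r) \<and> (\<forall>i. i \<notin> {1..n} \<longrightarrow> c i = 0)}"

definition exc :: "nat \<Rightarrow> (nat \<Rightarrow> nat) \<times> (nat \<Rightarrow> nat) \<Rightarrow> nat" where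
  "exc n \<sigma> = card {i\<in>{1..n}. fst \<sigma> i > i \<or> (fst \<sigma> i = i \<and> snd \<sigma> i > 0)}"

definition colored_derangements :: "nat \<Rightarrow> nat \<Rightarrow> ((nat \<Rightarrow> nat) \<times> (nat \<Rightarrow> nat)) set" where
  "colored_derangements n r = {\<sigma> \<in> colored_perms n r.
      \<forall>i\<in>{1..n}. \<not> (fst \<sigma> i = i \<and> snd \<sigma> i = 0)}"

definition d_nr :: "nat \<Rightarrow> nat \<Rightarrow> int poly" where
  "d_nr n r = (\<Sum>\<sigma>\<in>colored_derangements n r. monom 1 (exc n \<sigma>))"

end

theory Submission
  imports Defs
begin

text \<open>
  A lattice point of the open parallelepiped over \<open>P_m^t\<close> is a sequence of integers \<open>y\<^sub>1, \<dots>, y\<^sub>m, h\<close>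
  such that the successive ratios \<open>0, y\<^sub>1/t\<^sub>1, \<dots>, y\<^sub>m/t\<^sub>m, h\<close> grow by amounts strictly between 0 and 1.
  It is determined by the residues of \<open>y\<^sub>i\<close> modulo \<open>t\<^sub>i\<close>, so \<open>d_m^t\<close> enumerates residue sequences without
  equal consecutive ratios by descents. The sequences for \<open>s\<close> are those for \<open>\<mu>\<close> in which the first residue is 0
  (exactly what \<open>\<mu>\<close> forbids), so the sum of the two polynomials has a free first residue. Summing over
  the residues one level at a time can be done in closed form and gives, modulo every power of \<open>z\<close>,
  \[ (1 - z) \sum_t z^t (r t (1 - z) - z)^n . \]
  On the other side, summing over the colors turns \<open>d_{n,r}\<close> into a permanent; inserting the largest
  letter into a cycle gives a recurrence with a derivative, which the same series satisfies.
\<close>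

section \<open>Closed form of the residue recursion\<close>

definition zvar :: "int poly" where "zvar = monom 1 1"

text \<open>Expanded by the binomial theorem, this is inclusion-exclusion over fixed points of color
  0: \<open>(1 - z)^(k+1)\<close> times the series of \<open>(r t)^k z^t\<close> enumerates colored
  permutations by weak excedances. Cut off at \<open>N\<close> terms it stays a polynomial;
  comparisons with enumerators are made modulo \<open>zvar ^ N\<close>.\<close>

definition partial_numerator :: "nat \<Rightarrow> nat \<Rightarrow> nat \<Rightarrow> int poly" where
  "partial_numerator r N n = (1 - zvar) * (\<Sum>t<N. zvar ^ t * (of_nat (r * t) * (1 - zvar) - zvar) ^ n)"

text \<open>
  The enumerator of the residue sequences ending in \<open>e\<close> at the level with modulus \<open>m * r\<close> turns out to be
  \<open>(1 - z) \<Sum>t. z^t * level_poly m (m * r * t + e)\<close>; the formula for \<open>level_poly\<close> was found by solving the difference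
  equations in \<open>e\<close> that one step of the recursion imposes. \<open>level_antidiff m\<close> is an antidifference of \<open>(1 - z) level_poly m\<close>
  which agrees with \<open>level_poly (m + 1)\<close>, up to reindexing, away from the multiples of \<open>m + 1\<close>.
\<close>

definition level_poly :: "nat \<Rightarrow> nat \<Rightarrow> int poly" where
  "level_poly m y = (let w = of_nat (y div m) * (1 - zvar); b = y mod m in
     if b = 0 then (w - zvar) ^ (m - 1)
     else (w - zvar) ^ (m - 1 - b) * (w + 1 - zvar) * (w + 1 - 2 * zvar) ^ (b - 1))"

definition level_antidiff :: "nat \<Rightarrow> nat \<Rightarrow> int poly" where
  "level_antidiff m y = (let w = of_nat (y div m) * (1 - zvar); b = y mod m in
     if b = 0 then w * (w - zvar) ^ (m - 1)
     else (w - zvar) ^ (m - b) * (w + 1 - zvar) * (w + 1 - 2 * zvar) ^ (b - 1))"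

lemma level_antidiff_0 [simp]: "level_antidiff m 0 = 0"
  by (simp add: level_antidiff_def)

text \<open>Each step adds \<open>1 - zvar\<close> to one factor of the product: first to
  \<open>w\<close>, then to the factors \<open>w - zvar\<close> one by one. After the last of them
  the product has the initial form again, for the next block of \<open>m\<close> arguments.\<close>

lemma level_antidiff_Suc:
  assumes "m > 0"
  shows "level_antidiff m (Suc y) - level_antidiff m y = (1 - zvar) * level_poly m y"
proof -
  define b where "b = y mod m"
  define w where "w = of_nat (y div m) * (1 - zvar)"
  have bm: "b < m" using assms by (simp add: b_def)
  show ?thesis
  proof (cases "Suc b = m")
    case True
    have 1: "Suc y mod m = 0" "Suc y div m = Suc (y div m)"
      using True by (auto simp: b_def mod_Suc div_Suc)
    have 2: "level_antidiff m (Suc y) = (w + 1 - zvar) * (w + 1 - 2 * zvar) ^ (m - 1)"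
      by (simp add: level_antidiff_def 1 w_def algebra_simps)
    show ?thesis
    proof (cases b)
      case 0
      then show ?thesis unfolding 2 using True
        by (simp add: level_antidiff_def level_poly_def flip: b_def w_def)
    next
      case (Suc c)
      have m: "m = Suc (Suc c)" using True Suc by simp
      have 3: "level_antidiff m y = (w - zvar) * (w + 1 - zvar) * (w + 1 - 2 * zvar) ^ c"
        "level_poly m y = (w + 1 - zvar) * (w + 1 - 2 * zvar) ^ c"
        using Suc unfolding level_antidiff_def level_poly_def by (simp_all add: Let_def m flip: b_def[unfolded m] w_def[unfolded m])
      show ?thesis unfolding 2 3 by (simp add: m algebra_simps)
    qed
  next
    case False
    have 1: "Suc y mod m = Suc b" "Suc y div m = y div m"
      using False by (auto simp: b_def mod_Suc div_Suc)
    have 2: "level_antidiff m (Suc y) = (w - zvar) ^ (m - Suc b) * (w + 1 - zvar) * (w + 1 - 2 * zvar) ^ b"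
      by (simp add: level_antidiff_def 1 w_def Let_def)
    show ?thesis
    proof (cases b)
      case 0
      then have 3: "level_antidiff m y = w * (w - zvar) ^ (m - 1)" "level_poly m y = (w - zvar) ^ (m - 1)"
        unfolding level_antidiff_def level_poly_def Let_def b_def[symmetric] w_def[symmetric] by simp_all
      show ?thesis unfolding 2 3 by (simp add: 0 algebra_simps)
    next
      case (Suc c)
      have m: "m - b = Suc (m - Suc b)" using bm by simp
      have 3: "level_antidiff m y = (w - zvar) ^ Suc (m - Suc b) * (w + 1 - zvar) * (w + 1 - 2 * zvar) ^ c"
        "level_poly m y = (w - zvar) ^ (m - Suc b) * (w + 1 - zvar) * (w + 1 - 2 * zvar) ^ c"
        unfolding level_antidiff_def level_poly_def b_def[symmetric] w_def[symmetric] Let_def m using Suc by simp_all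
      show ?thesis unfolding 2 3 by (simp add: Suc algebra_simps)
    qed
  qed
qed

lemma sum_level_poly: "m > 0 \<Longrightarrow> (1 - zvar) * (\<Sum>y\<in>{a..<a + k}. level_poly m y) = level_antidiff m (a + k) - level_antidiff m a"
proof (induction k)
  case (Suc k)
  then show ?case using level_antidiff_Suc[of m "a + k"] by (simp add: algebra_simps)
qed simp

text \<open>The offset \<open>b\<close> is the same in blocks of length \<open>m + 1\<close> and of
  length \<open>m\<close>, and the exponents agree. Only for \<open>b = m\<close> does the right
  side pass to the next block, with remainder 0.\<close>

lemma level_poly_Suc_mult_add:
  assumes "0 < b" "b \<le> m"
  shows "level_poly (Suc m) (Suc m * q + b) = level_antidiff m (m * q + b)"
proof -
  have 1: "(Suc m * q + b) div Suc m = q" "(Suc m * q + b) mod Suc m = b"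
    using assms by (simp_all only: div_mult_self4 mod_mult_self4) auto
  show ?thesis
  proof (cases "b = m")
    case True
    have 2: "(m * q + b) div m = Suc q" "(m * q + b) mod m = 0"
      using assms True by auto
    show ?thesis unfolding level_poly_def level_antidiff_def 1 2 using assms True
      by (simp add: algebra_simps)
  next
    case False
    then have 2: "(m * q + b) div m = q" "(m * q + b) mod m = b"
      using assms by auto
    show ?thesis unfolding level_poly_def level_antidiff_def 1 2 using assms by simp
  qed
qed

text \<open>With \<open>w\<close> as before,
  \<open>(w - z)^m = w (w - z)^(m-1) - z (w - z)^(m-1)\<close>. The subtracted term will account for
  the excluded case of equal ratios.\<close>

lemma level_poly_Suc_mult:
  assumes "m > 0"
  shows "level_poly (Suc m) (Suc m * q) = level_antidiff m (m * q) - zvar * level_poly m (m * q)"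
proof -
  have 1: "(Suc m * q) div Suc m = q" "(Suc m * q) mod Suc m = 0"
    by (simp_all only: nonzero_mult_div_cancel_left mod_mult_self1_is_0)
  have 2: "(m * q) div m = q" "(m * q) mod m = 0" using assms by auto
  show ?thesis unfolding level_poly_def level_antidiff_def 1 2 using assms
    by (cases m) (simp_all add: algebra_simps)
qed

text \<open>
  One level of the residue recursion: if the residue \<open>j\<close> modulo \<open>b\<close> follows \<open>i\<close> modulo \<open>a\<close>, then the
  integer part of the ratio stays when \<open>i/a < j/b\<close>, increases by one when \<open>i/a > j/b\<close>, and
  \<open>i/a = j/b\<close> is impossible.
\<close>

definition residue_step :: "nat \<Rightarrow> nat \<Rightarrow> (nat \<Rightarrow> int poly) \<Rightarrow> nat \<Rightarrow> int poly" where
  "residue_step a b f j = (\<Sum>i<a. if i * b < j * a then f i else if j * a < i * b then zvar * f i else 0)"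

primrec residue_sum :: "(nat \<Rightarrow> nat) \<Rightarrow> (nat \<Rightarrow> int poly) \<Rightarrow> nat \<Rightarrow> nat \<Rightarrow> int poly" where
  "residue_sum \<tau> f 0 = f"
| "residue_sum \<tau> f (Suc m) = residue_step (\<tau> m) (\<tau> (Suc m)) (residue_sum \<tau> f m)"

lemma residue_step_add: "residue_step a b (\<lambda>i. f i + g i) j = residue_step a b f j + residue_step a b g j"
  unfolding residue_step_def by (simp add: sum.distrib[symmetric] distrib_left cong: sum.cong if_cong)
     (rule sum.cong, auto simp: algebra_simps)

text \<open>The step is linear, so the recursion can be followed modulo
  \<open>zvar ^ N\<close>.\<close>

lemma residue_step_dvd:
  assumes "\<And>i. i < a \<Longrightarrow> d dvd f i - g i"
  shows "d dvd residue_step a b f j - residue_step a b g j"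
  unfolding residue_step_def sum_subtractf[symmetric]
  by (rule dvd_sum) (use assms in \<open>auto simp flip: right_diff_distrib intro: dvd_mult\<close>)

text \<open>For \<open>j = Suc m * q + b\<close> the bound \<open>j m / (m + 1)\<close> on
  \<open>i\<close> equals \<open>m q + b - b / (m + 1)\<close>, which is no integer because
  \<open>0 < b \<le> m\<close>. So equal ratios do not occur, and the cut is at
  \<open>m * q + b\<close>.\<close>

lemma residue_step_cut:
  assumes "m > 0" "r > 0" "q < r" "0 < b" "b \<le> m"
  shows "residue_step (m * r) (Suc m * r) f (Suc m * q + b)
       = (\<Sum>i<m * q + b. f i) + zvar * (\<Sum>i\<in>{m * q + b..<m * r}. f i)"
proof -
  have kle: "m * q + b \<le> m * r"
  proof -
    have "m * q + b \<le> m * Suc q" using assms by simp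
    also have "\<dots> \<le> m * r" using assms by (intro mult_le_mono2) simp
    finally show ?thesis .
  qed
  have lt: "i * (Suc m * r) < (Suc m * q + b) * (m * r) \<longleftrightarrow> i < m * q + b" for i
  proof -
    have "i * (Suc m * r) < (Suc m * q + b) * (m * r) \<longleftrightarrow> (i * Suc m) * r < ((Suc m * q + b) * m) * r"
      by (simp only: mult.assoc)
    also have "\<dots> \<longleftrightarrow> i * Suc m < (Suc m * q + b) * m" using assms by simp
    also have "(Suc m * q + b) * m = Suc m * (m * q) + b * m" by (simp add: algebra_simps)
    also have "i * Suc m < Suc m * (m * q) + b * m \<longleftrightarrow> i < m * q + b"
    proof
      assume "i * Suc m < Suc m * (m * q) + b * m"
      also have "\<dots> < Suc m * (m * q + b)" using assms by (simp add: algebra_simps)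
      finally show "i < m * q + b" by (metis mult.commute mult_less_cancel2)
    next
      assume "i < m * q + b"
      then have "i + 1 \<le> m * q + b" by simp
      then have "Suc m * (i + 1) \<le> Suc m * (m * q + b)" by (rule mult_le_mono2)
      then show "i * Suc m < Suc m * (m * q) + b * m" using assms by (simp add: algebra_simps)
    qed
    finally show ?thesis .
  qed
  have gt: "(Suc m * q + b) * (m * r) < i * (Suc m * r) \<longleftrightarrow> m * q + b \<le> i" for i
  proof -
    have "i * (Suc m * r) \<noteq> (Suc m * q + b) * (m * r)"
    proof
      assume "i * (Suc m * r) = (Suc m * q + b) * (m * r)"
      then have "(i * Suc m) * r = ((Suc m * q + b) * m) * r" by (simp only: mult.assoc)
      then have "i * Suc m = (Suc m * q + b) * m" using assms by simp
      then have "Suc m dvd (Suc m * q + b) * m" by (metis dvd_triv_right)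
      moreover have "coprime (Suc m) m" by simp
      ultimately have "Suc m dvd Suc m * q + b" using coprime_dvd_mult_left_iff by blast
      then have "Suc m dvd b" by (metis dvd_add_right_iff dvd_triv_left)
      then show False using assms by (auto dest: dvd_imp_le)
    qed
    then show ?thesis using lt[of i] by linarith
  qed
  have "{..<m * r} = {..<m * q + b} \<union> {m * q + b..<m * r}" using kle by auto
  then have "residue_step (m * r) (Suc m * r) f (Suc m * q + b)
    = (\<Sum>i\<in>{..<m * q + b} \<union> {m * q + b..<m * r}. if i < m * q + b then f i else zvar * f i)"
    unfolding residue_step_def lt gt by (intro sum.cong) auto
  also have "\<dots> = (\<Sum>i<m * q + b. f i) + zvar * (\<Sum>i\<in>{m * q + b..<m * r}. f i)"
    by (subst sum.union_disjoint) (auto simp: sum_distrib_left)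
  finally show ?thesis .
qed

text \<open>Here the bound is the integer \<open>m * q\<close>: the ratios agree exactly at
  \<open>i = m * q\<close>, and that term is missing.\<close>

lemma residue_step_cut_0:
  assumes "m > 0" "r > 0" "q < r"
  shows "residue_step (m * r) (Suc m * r) f (Suc m * q)
       = (\<Sum>i<m * q. f i) + zvar * (\<Sum>i\<in>{m * q..<m * r}. f i) - zvar * f (m * q)"
proof -
  have kle: "m * q < m * r" using assms by simp
  have lt: "i * (Suc m * r) < (Suc m * q) * (m * r) \<longleftrightarrow> i < m * q" for i
  proof -
    have "i * (Suc m * r) < (Suc m * q) * (m * r) \<longleftrightarrow> i * (Suc m * r) < (m * q) * (Suc m * r)"
      by (simp only: mult_ac)
    then show ?thesis using assms by simp
  qed
  have gt: "(Suc m * q) * (m * r) < i * (Suc m * r) \<longleftrightarrow> m * q < i" for i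
  proof -
    have "(Suc m * q) * (m * r) < i * (Suc m * r) \<longleftrightarrow> (m * q) * (Suc m * r) < i * (Suc m * r)"
      by (simp only: mult_ac)
    then show ?thesis using assms by simp
  qed
  have "{..<m * r} = {..<m * q} \<union> {m * q..<m * r}" using kle by (auto intro: less_trans)
  then have "residue_step (m * r) (Suc m * r) f (Suc m * q)
    = (\<Sum>i\<in>{..<m * q} \<union> {m * q..<m * r}. if i < m * q then f i else if m * q < i then zvar * f i else 0)"
    unfolding residue_step_def lt gt by (intro sum.cong) auto
  also have "\<dots> = (\<Sum>i<m * q. f i) + (\<Sum>i\<in>{m * q..<m * r}. if m * q < i then zvar * f i else 0)"
    by (subst sum.union_disjoint) auto
  also have "(\<Sum>i\<in>{m * q..<m * r}. if m * q < i then zvar * f i else 0) = zvar * (\<Sum>i\<in>{m * q..<m * r}. f i) - zvar * f (m * q)"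
    using kle by (simp add: sum.atLeast_Suc_lessThan distrib_left sum_distrib_left)
  finally show ?thesis by simp
qed

definition level_sum :: "nat \<Rightarrow> nat \<Rightarrow> nat \<Rightarrow> nat \<Rightarrow> int poly" where
  "level_sum r N m j = (1 - zvar) * (\<Sum>t<N. zvar ^ t * level_poly m (m * (r * t) + j))"

lemma sum_level_sum: "m > 0 \<Longrightarrow> (\<Sum>i\<in>{a..<a + k}. level_sum r N m i)
   = (\<Sum>t<N. zvar ^ t * (level_antidiff m (m * (r * t) + a + k) - level_antidiff m (m * (r * t) + a)))"
proof -
  assume m: "m > 0"
  have "(\<Sum>i\<in>{a..<a + k}. level_sum r N m i)
     = (\<Sum>t<N. zvar ^ t * ((1 - zvar) * (\<Sum>i\<in>{a..<a + k}. level_poly m (m * (r * t) + i))))"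
    unfolding level_sum_def sum_distrib_left
    by (subst sum.swap) (simp add: mult_ac)
  also have "\<dots> = (\<Sum>t<N. zvar ^ t * (level_antidiff m (m * (r * t) + a + k) - level_antidiff m (m * (r * t) + a)))"
  proof (rule sum.cong[OF refl])
    fix t
    have "(\<Sum>i\<in>{a..<a + k}. level_poly m (m * (r * t) + i)) = (\<Sum>i\<in>{m * (r * t) + a..<m * (r * t) + a + k}. level_poly m i)"
      by (rule sum.reindex_bij_witness[of _ "\<lambda>i. i - m * (r * t)" "\<lambda>i. m * (r * t) + i"]) auto
    then show "zvar ^ t * ((1 - zvar) * (\<Sum>i\<in>{a..<a + k}. level_poly m (m * (r * t) + i))) = zvar ^ t * (level_antidiff m (m * (r * t) + a + k) - level_antidiff m (m * (r * t) + a))"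
      using sum_level_poly[OF m] by simp
  qed
  finally show ?thesis .
qed

text \<open>Both inner sums are differences of \<open>level_antidiff m\<close>. Its values at
  \<open>m r t\<close> and \<open>m r (t + 1)\<close> come with \<open>z^t\<close> and
  \<open>z^(t+1)\<close> and opposite signs, so they telescope; the value at 0 vanishes and the last
  one carries \<open>zvar ^ N\<close>.\<close>

lemma level_sum_cut:
  assumes "m > 0" "k \<le> m * r"
  shows "zvar ^ N dvd (\<Sum>i<k. level_sum r N m i) + zvar * (\<Sum>i\<in>{k..<m * r}. level_sum r N m i)
     - (1 - zvar) * (\<Sum>t<N. zvar ^ t * level_antidiff m (m * (r * t) + k))"
proof -
  obtain l where l: "m * r = k + l" using assms le_Suc_ex by blast
  have kl: "m * (r * t) + k + l = m * (r * Suc t)" for t using l by (simp add: algebra_simps)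
  have tel: "(\<Sum>t<N. zvar ^ Suc t * level_antidiff m (m * (r * Suc t)) - zvar ^ t * level_antidiff m (m * (r * t))) = zvar ^ N * level_antidiff m (m * (r * N))"
    by (subst sum_lessThan_telescope) simp
  have "(\<Sum>i<k. level_sum r N m i) + zvar * (\<Sum>i\<in>{k..<m * r}. level_sum r N m i)
     - (1 - zvar) * (\<Sum>t<N. zvar ^ t * level_antidiff m (m * (r * t) + k))
    = (\<Sum>t<N. zvar ^ t * (level_antidiff m (m * (r * t) + k) - level_antidiff m (m * (r * t)))
       + zvar * (zvar ^ t * (level_antidiff m (m * (r * Suc t)) - level_antidiff m (m * (r * t) + k)))
       - (1 - zvar) * (zvar ^ t * level_antidiff m (m * (r * t) + k)))"
    using sum_level_sum[OF assms(1), of r N 0 k] sum_level_sum[OF assms(1), of r N k l]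
    by (simp add: l kl sum.distrib sum_subtractf sum_distrib_left atLeast0LessThan)
  also have "\<dots> = (\<Sum>t<N. zvar ^ Suc t * level_antidiff m (m * (r * Suc t)) - zvar ^ t * level_antidiff m (m * (r * t)))"
    by (rule sum.cong) (auto simp: algebra_simps)
  finally show ?thesis by (simp only: tel dvd_triv_left)
qed

text \<open>Cutting at \<open>m * q + b\<close> produces antidifferences, that is, values of the
  next \<open>level_poly\<close>. If \<open>Suc m\<close> divides \<open>j\<close>, the term missing
  in \<open>residue_step_cut_0\<close> matches the correction in
  \<open>level_poly_Suc_mult\<close>.\<close>

lemma residue_step_level_sum:
  assumes "m > 0" "r > 0" "j < Suc m * r"
  shows "zvar ^ N dvd residue_step (m * r) (Suc m * r) (level_sum r N m) j - level_sum r N (Suc m) j"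
proof -
  define q b where "q = j div Suc m" and "b = j mod Suc m"
  have j: "j = Suc m * q + b" by (simp only: q_def b_def mult_div_mod_eq)
  have qr: "q < r" using assms(3) by (simp only: q_def less_mult_imp_div_less mult.commute)
  have b: "b \<le> m" using mod_less_divisor[of "Suc m" j] unfolding b_def by simp
  have kle: "m * q + b \<le> m * r"
  proof -
    have "m * q + b \<le> m * Suc q" using b by simp
    also have "\<dots> \<le> m * r" using qr by (intro mult_le_mono2) simp
    finally show ?thesis .
  qed
  show ?thesis
  proof (cases "b = 0")
    case False
    have "level_poly (Suc m) (Suc m * (r * t) + j) = level_antidiff m (m * (r * t) + (m * q + b))" for t
      using level_poly_Suc_mult_add[of b m "r * t + q"] False b unfolding j by (simp add: algebra_simps)
    then show ?thesis
      using level_sum_cut[OF assms(1) kle, of N] residue_step_cut[OF assms(1,2) qr _ b, of "level_sum r N m"] False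
      by (simp only: j level_sum_def[of r N "Suc m"])
  next
    case True
    have "level_poly (Suc m) (Suc m * (r * t) + j) = level_antidiff m (m * (r * t) + m * q) - zvar * level_poly m (m * (r * t) + m * q)" for t
      using level_poly_Suc_mult[of m "r * t + q"] True assms(1) unfolding j by (simp add: algebra_simps)
    then have "level_sum r N (Suc m) j = (1 - zvar) * (\<Sum>t<N. zvar ^ t * level_antidiff m (m * (r * t) + m * q)) - zvar * level_sum r N m (m * q)"
      by (simp only: level_sum_def) (simp add: sum_subtractf right_diff_distrib sum_distrib_left mult_ac)
    moreover have "residue_step (m * r) (Suc m * r) (level_sum r N m) j
       = (\<Sum>i<m * q. level_sum r N m i) + zvar * (\<Sum>i\<in>{m * q..<m * r}. level_sum r N m i) - zvar * level_sum r N m (m * q)"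
      using residue_step_cut_0[OF assms(1,2) qr] True unfolding j by simp
    ultimately show ?thesis
      using level_sum_cut[OF assms(1), of "m * q" r N] kle True by (simp add: diff_diff_eq2)
  qed
qed

lemma geometric_dvd: "zvar ^ N dvd 1 - (1 - zvar) * (\<Sum>t<N. zvar ^ t)"
  by (simp add: one_diff_power_eq[symmetric])

lemma residue_sum_level_sum:
  assumes "r > 0" "j < Suc k * r"
  shows "zvar ^ N dvd residue_sum (\<lambda>k. Suc k * r) (\<lambda>_. 1) k j - level_sum r N (Suc k) j"
  using assms(2)
proof (induction k arbitrary: j)
  case 0
  \<comment> \<open>\<open>level_poly 1\<close> is constantly 1, so the claim is about the geometric
    series.\<close>
  show ?case using geometric_dvd[of N] by (simp add: level_sum_def level_poly_def)
next
  case (Suc k)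
  have "zvar ^ N dvd residue_step (Suc k * r) (Suc (Suc k) * r) (residue_sum (\<lambda>k. Suc k * r) (\<lambda>_. 1) k) j
      - residue_step (Suc k * r) (Suc (Suc k) * r) (level_sum r N (Suc k)) j"
    by (rule residue_step_dvd) (rule Suc.IH)
  moreover have "zvar ^ N dvd residue_step (Suc k * r) (Suc (Suc k) * r) (level_sum r N (Suc k)) j - level_sum r N (Suc (Suc k)) j"
    using residue_step_level_sum[of "Suc k" r j N] assms(1) Suc.prems by blast
  ultimately show ?case unfolding residue_sum.simps by (metis dvd_add diff_add_cancel add_diff_eq)
qed

text \<open>At residue 0 of level \<open>n + 1\<close> only multiples of \<open>Suc n\<close> are
  evaluated, where \<open>level_poly\<close> is a pure power.\<close>

lemma residue_sum_partial_numerator: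
  assumes "r > 0"
  shows "zvar ^ N dvd residue_sum (\<lambda>k. Suc k * r) (\<lambda>_. 1) n 0 - partial_numerator r N n"
proof -
  have "level_poly (Suc n) (Suc n * (r * t) + 0) = (of_nat (r * t) * (1 - zvar) - zvar) ^ n" for t
  proof -
    have "(Suc n * (r * t)) div Suc n = r * t" "(Suc n * (r * t)) mod Suc n = 0"
      by (simp_all only: nonzero_mult_div_cancel_left mod_mult_self1_is_0)
    then show ?thesis unfolding level_poly_def by simp
  qed
  then have "level_sum r N (Suc n) 0 = partial_numerator r N n" by (simp only: level_sum_def partial_numerator_def)
  then show ?thesis using residue_sum_level_sum[OF assms, of 0 n N] assms by simp
qed

section \<open>Lattice points in the open parallelepiped\<close>

definition corner :: "nat list \<Rightarrow> nat \<Rightarrow> nat \<Rightarrow> real" where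
  "corner t j i = (if j \<le> i \<and> i < length t then real (t ! i) else 0)"

lemma Pt_iff:
  "x \<in> Pt t \<longleftrightarrow> (\<forall>i\<ge>length t. x i = 0) \<and>
     (\<forall>i<length t. 0 \<le> x i / real (t ! i) \<and> x i / real (t ! i) \<le> 1) \<and>
     (\<forall>i j. i \<le> j \<longrightarrow> j < length t \<longrightarrow> x i / real (t ! i) \<le> x j / real (t ! j))"
  (is "_ \<longleftrightarrow> ?R")
proof
  define q where "q i = x i / real (t ! i)" for i
  assume "x \<in> Pt t"
  then have x: "\<forall>i\<ge>length t. x i = 0" "length t > 0 \<longrightarrow> 0 \<le> q 0 \<and> q (length t - 1) \<le> 1"
    "\<And>i. i + 1 < length t \<Longrightarrow> q i \<le> q (i + 1)"
    by (simp_all add: Pt_def q_def Let_def)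
  have mono: "q i \<le> q j" if "i \<le> j" "j < length t" for i j
    using that
  proof (induction j rule: dec_induct)
    case (step j)
    then show ?case using x(3)[of j] by simp
  qed simp
  have "0 \<le> q i" "q i \<le> 1" if "i < length t" for i
    using mono[of 0 i] mono[of i "length t - 1"] x(2) that by fastforce+
  then show ?R using x(1) mono unfolding q_def by blast
next
  assume ?R
  then show "x \<in> Pt t" by (auto simp: Pt_def Let_def)
qed

text \<open>The coordinates of a corner are extreme in \<open>[0, t ! i]\<close>, so it is no proper
  midpoint. Conversely, a pair of monotone perturbations shows that every ratio of a vertex is 0 or
  1, and monotone sequences of zeros and ones are corners.\<close>

lemma vertices_Pt:
  assumes pos: "\<forall>a\<in>set t. 0 < a"
  shows "vertices (Pt t) = corner t ` {..length t}"
proof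
  have t: "real (t ! i) > 0" if "i < length t" for i using pos that by simp
  have tnz: "t ! i \<noteq> 0" if "i < length t" for i using t[OF that] by simp
  show "corner t ` {..length t} \<subseteq> vertices (Pt t)"
  proof safe
    fix j assume "j \<le> length t"
    have "corner t j \<in> Pt t"
      unfolding Pt_iff by (auto simp: corner_def tnz)
    moreover have "a = b" if ab: "a \<in> Pt t" "b \<in> Pt t" "corner t j = (\<lambda>i. (a i + b i) / 2)" for a b
    proof
      fix i
      have eq: "corner t j i = (a i + b i) / 2" using ab(3) by simp
      show "a i = b i"
      proof (cases "i < length t")
        case True
        then have "0 \<le> a i" "a i \<le> t ! i" "0 \<le> b i" "b i \<le> t ! i"
          using ab(1,2) t[OF True] unfolding Pt_iff by (auto simp: field_simps zero_le_divide_iff)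
        then show ?thesis using eq True by (auto simp: corner_def split: if_splits)
      next
        case False
        then show ?thesis using ab(1,2) by (simp add: Pt_iff)
      qed
    qed
    ultimately show "corner t j \<in> vertices (Pt t)" unfolding vertices_def by blast
  qed
  show "vertices (Pt t) \<subseteq> corner t ` {..length t}"
  proof
    fix x assume "x \<in> vertices (Pt t)"
    then have x: "x \<in> Pt t" and ext: "\<And>a b. a \<in> Pt t \<Longrightarrow> b \<in> Pt t \<Longrightarrow> x = (\<lambda>i. (a i + b i) / 2) \<Longrightarrow> a = b"
      unfolding vertices_def by blast+
    define q where "q i = x i / real (t ! i)" for i
    have q: "0 \<le> q i" "q i \<le> 1" if "i < length t" for i
      using x that unfolding Pt_iff q_def by auto
    have mono: "q i \<le> q j" if "i \<le> j" "j < length t" for i j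
      using x that unfolding Pt_iff q_def by auto
    have xq: "x i = (if i < length t then real (t ! i) * q i else 0)" for i
      using x t[of i] by (auto simp: q_def Pt_iff)
    have in_Pt: "(\<lambda>i. if i < length t then real (t ! i) * f (q i) else 0) \<in> Pt t"
      if "\<And>u v. 0 \<le> u \<Longrightarrow> u \<le> v \<Longrightarrow> v \<le> 1 \<Longrightarrow> 0 \<le> f u \<and> f u \<le> f v \<and> f v \<le> 1" for f :: "real \<Rightarrow> real"
    proof -
      have *: "(if i < length t then real (t ! i) * f (q i) else 0) / real (t ! i) = f (q i)"
        if "i < length t" for i using t[OF that] that by simp
      show ?thesis unfolding Pt_iff
      proof (intro conjI allI impI, goal_cases)
        case (4 i j)
        then have "f (q i) \<le> f (q j)" using that[of "q i" "q j"] q mono by auto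
        then show ?case using 4 by (subst (1 2) *) auto
      qed (use that q in \<open>auto simp: * simp del: if_split\<close>)
    qed
    \<comment> \<open>\<open>u\<close> is the mean of the two increasing self-maps \<open>u\<^sup>2\<close> and \<open>2u - u\<^sup>2\<close> of \<open>[0, 1]\<close>, which differ
      except at the end points.\<close>
    have "(\<lambda>i. if i < length t then real (t ! i) * (q i)\<^sup>2 else 0)
        = (\<lambda>i. if i < length t then real (t ! i) * (2 * q i - (q i)\<^sup>2) else 0)"
    proof (rule ext)
      show "(\<lambda>i. if i < length t then real (t ! i) * (q i)\<^sup>2 else 0) \<in> Pt t"
        by (rule in_Pt[of "\<lambda>u. u\<^sup>2"]) (auto intro: power_mono power_le_one)
      show "(\<lambda>i. if i < length t then real (t ! i) * (2 * q i - (q i)\<^sup>2) else 0) \<in> Pt t"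
      proof (rule in_Pt[of "\<lambda>u. 2 * u - u\<^sup>2"])
        fix u v :: real assume uv: "0 \<le> u" "u \<le> v" "v \<le> 1"
        have "0 \<le> u * (2 - u)" "0 \<le> (v - u) * (2 - u - v)" "0 \<le> (1 - v)\<^sup>2"
          using uv by auto
        then show "0 \<le> 2 * u - u\<^sup>2 \<and> 2 * u - u\<^sup>2 \<le> 2 * v - v\<^sup>2 \<and> 2 * v - v\<^sup>2 \<le> 1"
          by (simp add: power2_eq_square algebra_simps)
      qed
    qed (auto simp: xq fun_eq_iff algebra_simps)
    then have "real (t ! i) * (q i)\<^sup>2 = real (t ! i) * (2 * q i - (q i)\<^sup>2)" if "i < length t" for i
      using that by (metis (mono_tags, lifting))
    then have "(q i)\<^sup>2 = q i" if "i < length t" for i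
      using t[OF that] that by fastforce
    then have q01: "q i = 0 \<or> q i = 1" if "i < length t" for i
      using that by (simp add: power2_eq_square)
    \<comment> \<open>The position of the first ratio 1; \<open>length t\<close> stands for none,
      and then the point is the origin.\<close>
    define j where "j = (LEAST j. j = length t \<or> j < length t \<and> q j = 1)"
    have j: "j = length t \<or> j < length t \<and> q j = 1" unfolding j_def by (rule LeastI[of _ "length t"]) simp
    have less: "\<not> (i < length t \<and> q i = 1)" if "i < j" for i
      using not_less_Least[of i "\<lambda>j. j = length t \<or> j < length t \<and> q j = 1"] that unfolding j_def by blast
    have "x = corner t j"
    proof
      fix i
      consider "length t \<le> i" | "i < length t" "i < j" | "i < length t" "j \<le> i" by linarith
      then show "x i = corner t j i"
      proof cases
        case 2
        then show ?thesis using less q01 by (auto simp: xq corner_def)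
      next
        case 3
        then have "q i = 1" using j mono[of j i] q(2)[of i] by auto
        then show ?thesis using 3 by (simp add: xq corner_def)
      qed (simp add: xq corner_def)
    qed
    then show "x \<in> corner t ` {..length t}" using j by auto
  qed
qed

lemma inj_on_corner:
  assumes pos: "\<forall>a\<in>set t. 0 < a"
  shows "inj_on (corner t) {..length t}"
proof (rule linorder_inj_onI')
  fix i j assume "i \<in> {..length t}" "j \<in> {..length t}" "i < j"
  then have "corner t i i > 0" "corner t j i = 0"
    using pos by (auto simp: corner_def)
  then show "corner t i \<noteq> corner t j" by auto
qed

text \<open>Only the corners with \<open>j \<le> i\<close> contribute to coordinate
  \<open>i\<close>, each with \<open>t ! i\<close>. So the ratios of a lattice point are the partial
  sums of its coefficients, and the height is the full sum.\<close>

lemma open_par_lattice_Pt_iff: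
  assumes pos: "\<forall>a\<in>set t. 0 < a"
  shows "(y, h) \<in> open_par_lattice (length t) (vertices (Pt t)) \<longleftrightarrow>
     (\<forall>i\<ge>length t. y i = 0) \<and> (\<exists>l. (\<forall>j\<le>length t. 0 < l j \<and> l j < 1) \<and>
       (\<forall>i<length t. real_of_int (y i) = real (t ! i) * (\<Sum>j\<le>i. l j)) \<and>
       real_of_int h = (\<Sum>j\<le>length t. l j))"
proof -
  let ?m = "length t"
  note inj = inj_on_corner[OF pos]
  have coord: "(\<Sum>j\<le>?m. l j * corner t j i) = (if i < ?m then real (t ! i) * (\<Sum>j\<le>i. l j) else 0)"
    for l :: "nat \<Rightarrow> real" and i
  proof (cases "i < ?m")
    case True
    have "(\<Sum>j\<le>?m. l j * corner t j i) = (\<Sum>j\<le>i. l j * real (t ! i))"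
      using True by (intro sum.mono_neutral_cong_right) (auto simp: corner_def)
    then show ?thesis using True by (simp add: sum_distrib_left mult.commute[of _ "real (t ! i)"])
  qed (simp add: corner_def)
  have "(y, h) \<in> open_par_lattice ?m (vertices (Pt t)) \<longleftrightarrow> (\<forall>i\<ge>?m. y i = 0) \<and>
     (\<exists>lam. (\<forall>j\<le>?m. 0 < lam (corner t j) \<and> lam (corner t j) < 1) \<and>
          (\<forall>i. real_of_int (y i) = (\<Sum>j\<le>?m. lam (corner t j) * corner t j i)) \<and>
          real_of_int h = (\<Sum>j\<le>?m. lam (corner t j)))"
    unfolding open_par_lattice_def vertices_Pt[OF pos] by (simp add: sum.reindex[OF inj] o_def) (simp add: Ball_def)
  also have "\<dots> \<longleftrightarrow> (\<forall>i\<ge>?m. y i = 0) \<and>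
     (\<exists>l. (\<forall>j\<le>?m. 0 < l j \<and> l j < 1) \<and>
          (\<forall>i. real_of_int (y i) = (\<Sum>j\<le>?m. l j * corner t j i)) \<and>
          real_of_int h = (\<Sum>j\<le>?m. l j))" (is "_ \<and> ?L \<longleftrightarrow> _ \<and> ?R")
  proof -
    have ?L if ?R
    proof -
      from that obtain l where l: "\<forall>j\<le>?m. 0 < l j \<and> l j < 1"
        "\<forall>i. real_of_int (y i) = (\<Sum>j\<le>?m. l j * corner t j i)"
        "real_of_int h = (\<Sum>j\<le>?m. l j)" by blast
      define lam where "lam v = l (inv_into {..?m} (corner t) v)" for v
      have "lam (corner t j) = l j" if "j \<le> ?m" for j
        using inj that by (simp add: lam_def)
      then show ?L using l by (intro exI[of _ lam]) simp
    qed
    moreover have ?R if ?L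
    proof -
      from that obtain lam where "\<forall>j\<le>?m. 0 < lam (corner t j) \<and> lam (corner t j) < 1"
          "\<forall>i. real_of_int (y i) = (\<Sum>j\<le>?m. lam (corner t j) * corner t j i)"
          "real_of_int h = (\<Sum>j\<le>?m. lam (corner t j))" by blast
      then show ?R by (intro exI[of _ "\<lambda>j. lam (corner t j)"]) simp
    qed
    ultimately show ?thesis by blast
  qed
  also have "\<dots> \<longleftrightarrow> (\<forall>i\<ge>?m. y i = 0) \<and>
     (\<exists>l. (\<forall>j\<le>?m. 0 < l j \<and> l j < 1) \<and>
          (\<forall>i<?m. real_of_int (y i) = real (t ! i) * (\<Sum>j\<le>i. l j)) \<and>
          real_of_int h = (\<Sum>j\<le>?m. l j))"
    unfolding coord by (intro conj_cong refl ex_cong1) (auto split: if_splits)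
  finally show ?thesis .
qed

section \<open>Chains of ratios and their residues\<close>

definition chains :: "(nat \<Rightarrow> nat) \<Rightarrow> nat \<Rightarrow> (nat \<Rightarrow> int) set" where
  "chains \<tau> m = {y. y 0 = 0 \<and> (\<forall>i>m. y i = 0) \<and>
     (\<forall>i<m. y i / real (\<tau> i) < y (Suc i) / real (\<tau> (Suc i)) \<and>
            y (Suc i) / real (\<tau> (Suc i)) < y i / real (\<tau> i) + 1)}"

text \<open>The entries 1 at both ends let the initial ratio \<open>0\<close> and the height \<open>h\<close> be treated as ratios like the others.\<close>

definition augmented :: "nat list \<Rightarrow> nat \<Rightarrow> nat" where
  "augmented t i = (if 0 < i \<and> i \<le> length t then t ! (i - 1) else 1)"

text \<open>\<open>ex\<close> puts 0 in front of the coordinates and the height behind them, and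
  \<open>ct\<close> undoes this. The coefficients are the increments of successive ratios, so they
  lie strictly between 0 and 1 exactly when the extended sequence is a chain.\<close>

lemma d_t_eq_sum_chains:
  assumes pos: "\<forall>a\<in>set t. 0 < a"
  shows "d_t t = (\<Sum>y\<in>chains (augmented t) (Suc (length t)). monom 1 (nat (y (Suc (length t)))))"
proof -
  let ?m = "length t"
  define ex :: "(nat \<Rightarrow> int) \<times> int \<Rightarrow> nat \<Rightarrow> int" where
    "ex = (\<lambda>(y, h) i. if i = 0 then 0 else if i = Suc ?m then h else y (i - 1))"
  define ct :: "(nat \<Rightarrow> int) \<Rightarrow> (nat \<Rightarrow> int) \<times> int" where
    "ct Y = ((\<lambda>i. if i < ?m then Y (Suc i) else 0), Y (Suc ?m))" for Y
  have t: "real (t ! i) > 0" if "i < ?m" for i using pos that by simp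
  have mem: "(y, h) \<in> open_par_lattice ?m (vertices (Pt t)) \<longleftrightarrow> ex (y, h) \<in> chains (augmented t) (Suc ?m)"
    if y0: "\<forall>i\<ge>?m. y i = 0" for y h
  proof -
    define q where "q i = ex (y, h) i / real (augmented t i)" for i
    have q0: "q 0 = 0" by (simp add: q_def ex_def)
    have qm: "q (Suc ?m) = h" by (simp add: q_def ex_def augmented_def)
    have qS: "q (Suc i) = y i / real (t ! i)" if "i < ?m" for i
      using that by (simp add: q_def ex_def augmented_def)
    have "ex (y, h) \<in> chains (augmented t) (Suc ?m) \<longleftrightarrow> (\<forall>i\<le>?m. q i < q (Suc i) \<and> q (Suc i) < q i + 1)"
      using y0 by (auto simp: chains_def q_def ex_def less_Suc_eq_le)
    also have "\<dots> \<longleftrightarrow> (\<exists>l. (\<forall>j\<le>?m. 0 < l j \<and> l j < 1) \<and>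
       (\<forall>i<?m. real_of_int (y i) = real (t ! i) * (\<Sum>j\<le>i. l j)) \<and>
       real_of_int h = (\<Sum>j\<le>?m. l j))" (is "?L \<longleftrightarrow> (\<exists>l. ?R l)")
    proof
      assume L: ?L
      define l where "l i = q (Suc i) - q i" for i
      have sum_l: "(\<Sum>j\<le>i. l j) = q (Suc i)" for i
        using sum_lessThan_telescope[of q "Suc i"] by (simp add: l_def q0 lessThan_Suc_atMost)
      have "?R l"
        unfolding sum_l using L t by (auto simp: l_def qS qm algebra_simps)
      then show "\<exists>l. ?R l" by blast
    next
      assume "\<exists>l. ?R l"
      then obtain l where l: "?R l" by (elim exE)
      have "q (Suc i) = (\<Sum>j\<le>i. l j)" if "i \<le> ?m" for i
      proof (cases "i = ?m")
        case False
        then have "i < ?m" using that by simp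
        then show ?thesis using l t[of i] by (simp add: qS)
      qed (use l qm in simp)
      then have "q (Suc i) = q i + l i" if "i \<le> ?m" for i
        using that q0 by (cases i) auto
      then show ?L using l by simp
    qed
    finally show ?thesis unfolding open_par_lattice_Pt_iff[OF pos] using y0 by blast
  qed
  have van: "\<forall>i\<ge>?m. y i = 0" if "(y, h) \<in> open_par_lattice ?m V" for y h V
    using that by (simp add: open_par_lattice_def)
  have ct_ex: "ct (ex (y, h)) = (y, h)" if "\<forall>i\<ge>?m. y i = 0" for y h
    using that by (auto simp: ct_def ex_def fun_eq_iff)
  have ex_ct: "ex (ct Y) = Y" if "Y \<in> chains (augmented t) (Suc ?m)" for Y
    using that by (auto simp: ct_def ex_def chains_def fun_eq_iff)
  show ?thesis unfolding d_t_def ell_star_def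
  proof (rule sum.reindex_bij_witness[of _ ct ex], goal_cases)
    case (1 a)
    then show ?case using ct_ex van by (cases a) blast
  next
    case (2 a)
    then show ?case using mem van by (cases a) blast
  next
    case (3 b)
    then show ?case by (rule ex_ct)
  next
    case (4 b)
    have "\<forall>i\<ge>?m. fst (ct b) i = 0" by (simp add: ct_def)
    then show ?case using mem[of "fst (ct b)" "snd (ct b)"] ex_ct[OF 4] 4 by simp
  qed (auto simp: ex_def)
qed

text \<open>The upper bound makes \<open>chains\<close> finite; the lower one makes the quotients
  nonnegative, so that \<open>nat\<close> respects the sums in the exponents.\<close>

lemma chains_bounds:
  assumes "y \<in> chains \<tau> m" "i \<le> m"
  shows "0 \<le> y i / real (\<tau> i) \<and> y i / real (\<tau> i) \<le> real i"
  using assms(2)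
proof (induction i)
  case 0
  then show ?case using assms(1) by (simp add: chains_def)
next
  case (Suc i)
  then have "y i / real (\<tau> i) < y (Suc i) / real (\<tau> (Suc i)) \<and> y (Suc i) / real (\<tau> (Suc i)) < y i / real (\<tau> i) + 1"
    using assms(1) by (simp add: chains_def)
  then show ?case using Suc by auto
qed

lemma chains_Suc_iff:
  "Y \<in> chains \<tau> (Suc m) \<longleftrightarrow> Y(Suc m := 0) \<in> chains \<tau> m \<and>
     Y m / real (\<tau> m) < Y (Suc m) / real (\<tau> (Suc m)) \<and>
     Y (Suc m) / real (\<tau> (Suc m)) < Y m / real (\<tau> m) + 1"
  (is "?L \<longleftrightarrow> ?A \<and> ?B")
proof -
  have "?A \<longleftrightarrow> Y 0 = 0 \<and> (\<forall>i>Suc m. Y i = 0) \<and>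
     (\<forall>i<m. Y i / real (\<tau> i) < Y (Suc i) / real (\<tau> (Suc i)) \<and>
            Y (Suc i) / real (\<tau> (Suc i)) < Y i / real (\<tau> i) + 1)"
    unfolding chains_def by (auto simp: less_Suc_eq)
  then show ?thesis unfolding chains_def by (auto simp: less_Suc_eq)
qed

lemma finite_chains:
  assumes "\<And>i. 0 < \<tau> i"
  shows "finite (chains \<tau> m)"
proof (induction m)
  case 0
  have "chains \<tau> 0 \<subseteq> {\<lambda>_. 0}"
    by (auto simp: chains_def fun_eq_iff) (metis gr0I)
  then show ?case by (rule finite_subset) simp
next
  case (Suc m)
  have "chains \<tau> (Suc m) \<subseteq> (\<lambda>(y, v). y(Suc m := v)) ` (chains \<tau> m \<times> {0..int (Suc m * \<tau> (Suc m))})"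
  proof
    fix Y assume Y: "Y \<in> chains \<tau> (Suc m)"
    have "0 \<le> real_of_int (Y (Suc m))" "real_of_int (Y (Suc m)) \<le> real (Suc m) * real (\<tau> (Suc m))"
      using chains_bounds[OF Y order_refl] assms[of "Suc m"]
      by (auto simp: zero_le_divide_iff pos_divide_le_eq simp del: of_nat_Suc)
    then have "0 \<le> Y (Suc m)" "Y (Suc m) \<le> int (Suc m * \<tau> (Suc m))"
      by (simp, metis of_int_le_iff of_int_of_nat_eq of_nat_mult)
    moreover have "Y = (Y(Suc m := 0))(Suc m := Y (Suc m))" by auto
    ultimately show "Y \<in> (\<lambda>(y, v). y(Suc m := v)) ` (chains \<tau> m \<times> {0..int (Suc m * \<tau> (Suc m))})"
      using Y chains_Suc_iff by (intro image_eqI[of _ _ "(Y(Suc m := 0), Y (Suc m))"]) auto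
  qed
  then show ?case by (rule finite_subset) (use Suc in auto)
qed

text \<open>With integer parts split off, the ratios differ by \<open>\<delta> + \<rho>\<close>,
  where \<open>\<delta>\<close> is an integer and \<open>-1 < \<rho> < 1\<close>. This lies strictly
  between 0 and 1 just when \<open>\<rho> > 0\<close> and \<open>\<delta> = 0\<close>, or
  \<open>\<rho> < 0\<close> and \<open>\<delta> = 1\<close>.\<close>

lemma ratio_window_iff:
  fixes u v :: int and a b :: nat
  assumes "a > 0" "b > 0"
  shows "u / real a < v / real b \<and> v / real b < u / real a + 1 \<longleftrightarrow>
     (u mod a) * b \<noteq> (v mod b) * a \<and>
     v div b = u div a + (if (u mod a) * b < (v mod b) * a then 0 else 1)"
proof -
  define i j \<delta> where "i = u mod a" and "j = v mod b" and "\<delta> = v div b - u div a"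
  define \<rho> where "\<rho> = j / real b - i / real a"
  have u: "u / real a = u div a + i / real a" and v: "v / real b = v div b + j / real b"
    using assms unfolding i_def j_def
    by (simp_all add: field_simps) (metis of_int_add of_int_mult of_int_of_nat_eq mult_div_mod_eq mult.commute add.commute)+
  have ij: "0 \<le> i / real a" "i / real a < 1" "0 \<le> j / real b" "j / real b < 1"
  proof -
    have "i < int a" "j < int b" using assms by (simp_all add: i_def j_def)
    then have "real_of_int i < real a" "real_of_int j < real b" by linarith+
    then show "0 \<le> i / real a" "i / real a < 1" "0 \<le> j / real b" "j / real b < 1"
      using assms by (simp_all add: i_def j_def)
  qed
  have "i * b < j * a \<longleftrightarrow> real_of_int (i * b) < real_of_int (j * a)" by (simp only: of_int_less_iff)
  also have "\<dots> \<longleftrightarrow> 0 < \<rho>"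
    using assms by (simp add: \<rho>_def field_simps)
  finally have lt: "i * b < j * a \<longleftrightarrow> 0 < \<rho>" .
  have "i * b = j * a \<longleftrightarrow> real_of_int (i * b) = real_of_int (j * a)" by (simp only: of_int_eq_iff)
  also have "\<dots> \<longleftrightarrow> \<rho> = 0"
    using assms by (auto simp: \<rho>_def field_simps)
  finally have eq: "i * b = j * a \<longleftrightarrow> \<rho> = 0" .
  have "u / real a < v / real b \<and> v / real b < u / real a + 1 \<longleftrightarrow> 0 < \<delta> + \<rho> \<and> \<delta> + \<rho> < 1"
    unfolding u v \<delta>_def \<rho>_def by auto
  also have "\<dots> \<longleftrightarrow> \<rho> \<noteq> 0 \<and> \<delta> = (if 0 < \<rho> then 0 else 1)"
  proof -
    have "-1 < \<rho>" "\<rho> < 1" using ij by (auto simp: \<rho>_def)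
    \<comment> \<open>The one consequence of integrality that is used: \<open>\<delta>\<close>
      avoids the open gaps around 0 and 1.\<close>
    moreover have "real_of_int \<delta> \<le> -1 \<and> \<delta> \<noteq> 0 \<and> \<delta> \<noteq> 1 \<or> \<delta> = 0 \<or> \<delta> = 1 \<or> real_of_int \<delta> \<ge> 2 \<and> \<delta> \<noteq> 0 \<and> \<delta> \<noteq> 1"
      by auto
    ultimately show ?thesis by auto
  qed
  finally show ?thesis unfolding lt[symmetric] eq[symmetric] unfolding i_def j_def \<delta>_def by auto
qed

text \<open>By \<open>ratio_window_iff\<close>, a chain and the residue of the next entry determine
  that entry, if there is one. Grouping the shorter chains by the residue of their last entry then
  gives \<open>residue_step\<close>.\<close>

lemma sum_chains_eq_residue_sum:
  assumes pos: "\<And>i. 0 < \<tau> i" and \<tau>0: "\<tau> 0 = 1" and j: "j < \<tau> m"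
  shows "(\<Sum>y | y \<in> chains \<tau> m \<and> y m mod int (\<tau> m) = int j. zvar ^ nat (y m div int (\<tau> m))) = residue_sum \<tau> (\<lambda>_. 1) m j"
  using j
proof (induction m arbitrary: j)
  case 0
  have "{y. y \<in> chains \<tau> 0 \<and> y 0 mod int (\<tau> 0) = int j} = {\<lambda>_. 0}"
    using 0 \<tau>0 by (auto simp: chains_def fun_eq_iff) (metis gr0I)
  then show ?case by simp
next
  case (Suc m)
  define a b where "a = \<tau> m" and "b = \<tau> (Suc m)"
  have ab: "a > 0" "b > 0" using pos by (simp_all add: a_def b_def)
  have jb: "j < b" using Suc.prems by (simp add: b_def)
  \<comment> \<open>The growth of the integer part, so that \<open>g\<close> below is the forced
    next entry. For equal fractional parts the value 1 is arbitrary: such \<open>y\<close> are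
    excluded from the sum.\<close>
  define up where "up i = (if i * int b < int j * int a then 0 else 1::int)" for i
  define g where "g y = int b * (y m div int a + up (y m mod int a)) + int j" for y :: "nat \<Rightarrow> int"
  have g: "g y mod int b = int j" "g y div int b = y m div int a + up (y m mod int a)" for y
    using jb by (simp_all add: g_def)
  have y_nonneg: "0 \<le> y m div int a" if "y \<in> chains \<tau> m" for y
    using chains_bounds[OF that order_refl] ab by (simp add: a_def zero_le_divide_iff pos_imp_zdiv_nonneg_iff)
  let ?w = "\<lambda>i. if i * b < j * a then 1 else if j * a < i * b then zvar else 0"
  have "(\<Sum>Y | Y \<in> chains \<tau> (Suc m) \<and> Y (Suc m) mod int b = int j. zvar ^ nat (Y (Suc m) div int b))
      = (\<Sum>y | y \<in> chains \<tau> m \<and> (y m mod int a) * int b \<noteq> int j * int a. zvar ^ nat (y m div int a + up (y m mod int a)))"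
  proof (rule sum.reindex_bij_witness[of _ "\<lambda>y. y(Suc m := g y)" "\<lambda>Y. Y(Suc m := 0)"], goal_cases)
    case (1 Y)
    then have "Y (Suc m) div int b = Y m div int a + up (Y m mod int a)"
      unfolding chains_Suc_iff a_def[symmetric] b_def[symmetric] ratio_window_iff[OF ab] by (auto simp: up_def)
    then have "Y (Suc m) = g Y" using 1 by (metis (mono_tags, lifting) g_def mem_Collect_eq mult_div_mod_eq)
    then show ?case by (auto simp: g_def fun_eq_iff)
  next
    case (2 Y)
    then show ?case
      unfolding chains_Suc_iff a_def[symmetric] b_def[symmetric] ratio_window_iff[OF ab] by auto
  next
    case (3 y)
    then show ?case by (auto simp: chains_def)
  next
    case (4 y)
    have "y(Suc m := 0) = y" using 4 by (auto simp: chains_def)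
    then show ?case using 4 g[of y]
      unfolding chains_Suc_iff a_def[symmetric] b_def[symmetric] ratio_window_iff[OF ab] by (simp add: up_def)
  next
    case (5 Y)
    then have "Y (Suc m) div int b = Y m div int a + up (Y m mod int a)"
      unfolding chains_Suc_iff a_def[symmetric] b_def[symmetric] ratio_window_iff[OF ab] by (auto simp: up_def)
    then show ?case by simp
  qed
  \<comment> \<open>Chains with equal fractional parts come back with weight 0.\<close>
  also have "\<dots> = (\<Sum>y\<in>chains \<tau> m. ?w (nat (y m mod int a)) * zvar ^ nat (y m div int a))"
  proof (rule sum.mono_neutral_cong_left)
    show "finite (chains \<tau> m)" using pos by (rule finite_chains)
    have nat_iff: "nat (y m mod int a) * b < j * a \<longleftrightarrow> (y m mod int a) * int b < int j * int a"
      "j * a < nat (y m mod int a) * b \<longleftrightarrow> int j * int a < (y m mod int a) * int b" for y :: "nat \<Rightarrow> int"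
    proof -
      have "int (nat (y m mod int a)) = y m mod int a" using ab by simp
      then show "nat (y m mod int a) * b < j * a \<longleftrightarrow> (y m mod int a) * int b < int j * int a"
        "j * a < nat (y m mod int a) * b \<longleftrightarrow> int j * int a < (y m mod int a) * int b"
        by (metis of_nat_less_iff of_nat_mult)+
    qed
    show "\<forall>y\<in>chains \<tau> m - {y. y \<in> chains \<tau> m \<and> (y m mod int a) * int b \<noteq> int j * int a}.
        ?w (nat (y m mod int a)) * zvar ^ nat (y m div int a) = 0"
      unfolding nat_iff by auto
    fix y assume y: "y \<in> {y. y \<in> chains \<tau> m \<and> (y m mod int a) * int b \<noteq> int j * int a}"
    then show "zvar ^ nat (y m div int a + up (y m mod int a)) = ?w (nat (y m mod int a)) * zvar ^ nat (y m div int a)"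
      unfolding nat_iff using y_nonneg[of y] by (auto simp: up_def nat_add_distrib)
  qed auto
  also have "\<dots> = (\<Sum>i<a. \<Sum>y | y \<in> chains \<tau> m \<and> nat (y m mod int a) = i. ?w (nat (y m mod int a)) * zvar ^ nat (y m div int a))"
    by (rule sum.group[symmetric]) (use pos ab in \<open>auto simp: finite_chains nat_less_iff\<close>)
  also have "\<dots> = (\<Sum>i<a. ?w i * (\<Sum>y | y \<in> chains \<tau> m \<and> y m mod int a = int i. zvar ^ nat (y m div int a)))"
  proof (rule sum.cong[OF refl])
    fix i
    have "nat (y m mod int a) = i \<longleftrightarrow> y m mod int a = int i" for y :: "nat \<Rightarrow> int"
      using ab by (auto simp: nat_eq_iff)
    then show "(\<Sum>y | y \<in> chains \<tau> m \<and> nat (y m mod int a) = i. ?w (nat (y m mod int a)) * zvar ^ nat (y m div int a))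
       = ?w i * (\<Sum>y | y \<in> chains \<tau> m \<and> y m mod int a = int i. zvar ^ nat (y m div int a))"
      unfolding sum_distrib_left by (intro sum.cong) auto
  qed
  also have "\<dots> = (\<Sum>i<a. ?w i * residue_sum \<tau> (\<lambda>_. 1) m i)"
    using Suc.IH by (simp add: a_def)
  also have "\<dots> = residue_sum \<tau> (\<lambda>_. 1) (Suc m) j"
    unfolding residue_sum.simps residue_step_def a_def b_def by (intro sum.cong) auto
  finally show ?case by (simp add: b_def)
qed

text \<open>The last modulus is 1, so every chain has residue 0 there and the quotient is the height
  itself.\<close>

lemma d_t_eq_residue_sum:
  assumes pos: "\<forall>a\<in>set t. 0 < a"
  shows "d_t t = residue_sum (augmented t) (\<lambda>_. 1) (Suc (length t)) 0"
proof -
  have aug: "0 < augmented t i" "augmented t 0 = 1" "augmented t (Suc (length t)) = 1" for i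
    using pos by (auto simp: augmented_def)
  have "d_t t = (\<Sum>y | y \<in> chains (augmented t) (Suc (length t)) \<and> y (Suc (length t)) mod int (augmented t (Suc (length t))) = int 0.
      zvar ^ nat (y (Suc (length t)) div int (augmented t (Suc (length t)))))"
    unfolding d_t_eq_sum_chains[OF pos] by (simp add: aug(3) zvar_def monom_power)
  also have "\<dots> = residue_sum (augmented t) (\<lambda>_. 1) (Suc (length t)) 0"
    by (rule sum_chains_eq_residue_sum) (use aug in auto)
  finally show ?thesis .
qed

section \<open>The two sequences of multiples of r\<close>

lemma residue_step_0: "b > 0 \<Longrightarrow> residue_step a b f 0 = (\<Sum>i\<in>{1..<a}. zvar * f i)"
  unfolding residue_step_def by (rule sum.mono_neutral_cong_right) auto

lemma residue_sum_add:
  "residue_sum \<tau> (\<lambda>i. f i + g i) m j = residue_sum \<tau> f m j + residue_sum \<tau> g m j"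
proof (induction m arbitrary: j)
  case (Suc m)
  have "residue_sum \<tau> (\<lambda>i. f i + g i) m = (\<lambda>i. residue_sum \<tau> f m i + residue_sum \<tau> g m i)"
    using Suc by blast
  then show ?case by (simp add: residue_step_add)
qed simp

text \<open>The augmented moduli are 1, r, 2r, ..., nr, 1. The first step leads from ratio 0 to
  every residue modulo \<open>r\<close> except 0, which shifts the recursion by one level.\<close>

lemma d_t_multiples_from_1:
  assumes "n > 0" "r > 0"
  shows "d_t (map (\<lambda>k. k * r) [1..<n+1]) = residue_sum (\<lambda>k. Suc k * r) (\<lambda>i. if i = 0 then 0 else 1) n 0"
proof -
  define t where "t = map (\<lambda>k. k * r) [1..<n+1]"
  have len: "length t = n" by (simp add: t_def)
  have aug: "augmented t (Suc k) = Suc k * r" if "k < n" for k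
    using that by (simp add: augmented_def len) (simp add: t_def del: upt_Suc)
  have eq: "residue_sum (augmented t) (\<lambda>_. 1) (Suc k) j = residue_sum (\<lambda>k. Suc k * r) (\<lambda>i. if i = 0 then 0 else 1) k j"
    if "k < n" for k j
    using that
  proof (induction k arbitrary: j)
    case 0
    have "augmented t 0 = 1" by (simp add: augmented_def)
    then show ?case using aug[of 0] 0 assms by (auto simp: residue_step_def)
  next
    case (Suc k)
    then have "residue_sum (augmented t) (\<lambda>_. 1) (Suc k) = residue_sum (\<lambda>k. Suc k * r) (\<lambda>i. if i = 0 then 0 else 1) k"
      by auto
    then show ?case using aug[of k] aug[of "Suc k"] Suc.prems by (simp only: residue_sum.simps)
  qed
  obtain k where k: "n = Suc k" using assms gr0_implies_Suc by blast
  have "d_t t = residue_sum (augmented t) (\<lambda>_. 1) (Suc n) 0"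
    using d_t_eq_residue_sum[of t] assms by (auto simp: len) (auto simp: t_def)
  also have "\<dots> = (\<Sum>i\<in>{1..<n * r}. zvar * residue_sum (augmented t) (\<lambda>_. 1) n i)"
  proof -
    have "augmented t n = n * r" "augmented t (Suc n) = 1" using aug[of k] k by (simp_all add: augmented_def[of _ "Suc (Suc k)"] len)
    then show ?thesis unfolding residue_sum.simps(2)[of _ _ n] by (simp only: residue_step_0 zero_less_one)
  qed
  also have "\<dots> = (\<Sum>i\<in>{1..<n * r}. zvar * residue_sum (\<lambda>k. Suc k * r) (\<lambda>i. if i = 0 then 0 else 1) k i)"
    using eq[of k] k by simp
  \<comment> \<open>A step to residue 0 does not depend on the target modulus, so the final 1 may be
    replaced by \<open>Suc n * r\<close>.\<close>
  also have "\<dots> = residue_sum (\<lambda>k. Suc k * r) (\<lambda>i. if i = 0 then 0 else 1) n 0"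
    using assms by (simp add: k residue_step_0)
  finally show ?thesis by (simp add: t_def)
qed

text \<open>The augmented moduli are 1, 2r, ..., nr, 1. The initial 1 may be replaced by
  \<open>r\<close> with only residue 0 allowed, since residue 0 means ratio 0 for either
  modulus.\<close>

lemma d_t_multiples_from_2:
  assumes "n > 0" "r > 0"
  shows "d_t (map (\<lambda>k. k * r) [2..<n+1]) = residue_sum (\<lambda>k. Suc k * r) (\<lambda>i. if i = 0 then 1 else 0) n 0"
proof -
  define t where "t = map (\<lambda>k. k * r) [2..<n+1]"
  obtain k where k: "n = Suc k" using assms gr0_implies_Suc by blast
  have len: "length t = k" by (simp add: t_def k del: upt_Suc)
  have aug: "augmented t i = Suc i * r" if "0 < i" "i \<le> k" for i
    using that by (cases i) (simp_all add: augmented_def len t_def k del: upt_Suc)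
  have first: "residue_step 1 b (\<lambda>_. 1) j = residue_step r b' (\<lambda>i. if i = 0 then 1 else 0) j" if "b > 0" "b' > 0" for b b' j
  proof -
    have "residue_step r b' (\<lambda>i. if i = 0 then 1 else 0) j = (\<Sum>i\<in>{0::nat}. if 0 < j then 1 else 0)"
      unfolding residue_step_def using assms that by (intro sum.mono_neutral_cong_right) auto
    then show ?thesis by (simp add: residue_step_def)
  qed
  have aug0: "augmented t 0 = 1" by (simp add: augmented_def)
  have eq: "residue_sum (augmented t) (\<lambda>_. 1) (Suc i) j = residue_sum (\<lambda>k. Suc k * r) (\<lambda>i. if i = 0 then 1 else 0) (Suc i) j"
    if "Suc i \<le> k" for i j
    using that
  proof (induction i arbitrary: j)
    case 0
    then show ?case using aug0 aug[of 1] first[of "r + r" "r + r" j] assms by simp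
  next
    case (Suc i)
    then have "residue_sum (augmented t) (\<lambda>_. 1) (Suc i) = residue_sum (\<lambda>k. Suc k * r) (\<lambda>i. if i = 0 then 1 else 0) (Suc i)"
      by auto
    then show ?case using aug[of "Suc i"] aug[of "Suc (Suc i)"] Suc.prems
      by (simp only: residue_sum.simps(2)[of _ _ "Suc i"])
  qed
  have augn: "augmented t n = 1" by (simp add: augmented_def len k)
  have "d_t t = residue_sum (augmented t) (\<lambda>_. 1) n 0"
    using d_t_eq_residue_sum[of t] assms by (auto simp: len k) (auto simp: t_def)
  also have "\<dots> = residue_sum (\<lambda>k. Suc k * r) (\<lambda>i. if i = 0 then 1 else 0) n 0"
  proof (cases k)
    \<comment> \<open>For \<open>n = 1\<close> the list is empty, and a single step joins the
      initial and the final modulus 1.\<close>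
    case 0
    then show ?thesis using k aug0 augn first[of 1 "r + r" 0] assms by simp
  next
    case (Suc l)
    have "residue_sum (augmented t) (\<lambda>_. 1) k = residue_sum (\<lambda>k. Suc k * r) (\<lambda>i. if i = 0 then 1 else 0) k"
      using eq[of l] Suc by blast
    then show ?thesis using aug[of k] augn assms Suc
      unfolding k residue_sum.simps(2)[of _ _ k] by (simp add: residue_step_0 del: residue_sum.simps)
  qed
  finally show ?thesis by (simp add: t_def)
qed

section \<open>Colored derangements as a permanent\<close>

lemma zvar_eq: "zvar = [:0, 1:]"
  by (simp add: zvar_def monom_Suc monom_0)

lemma pderiv_zvar [simp]: "pderiv zvar = 1"
  by (simp add: zvar_eq pderiv_pCons)

lemma pderiv_of_nat_poly [simp]: "pderiv (of_nat k :: int poly) = 0"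
  by (simp add: of_nat_poly pderiv_pCons)

lemma pderiv_sum: "pderiv (\<Sum>x\<in>A. f x) = (\<Sum>x\<in>A. pderiv (f x))"
  by (induction A rule: infinite_finite_induct) (simp_all add: pderiv_add)

lemma monom_1_eq_zvar_power: "monom 1 n = zvar ^ n"
  by (simp add: zvar_def monom_power)

text \<open>The factor \<open>zvar\<close> restores the power lost by differentiation. So a
  recurrence with \<open>z d/dz\<close> can be compared modulo \<open>zvar ^ N\<close> without loss
  of precision.\<close>

lemma zvar_power_dvd_pderiv:
  assumes "zvar ^ N dvd f"
  shows "zvar ^ N dvd zvar * pderiv f"
proof -
  obtain g where "f = zvar ^ N * g" using assms by (elim dvdE)
  then show ?thesis
    by (cases N) (simp_all add: pderiv_mult pderiv_power_Suc distrib_left mult.left_commute[of zvar] dvd_smult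
        del: power_Suc flip: power_Suc)
qed

text \<open>This holds term by term in \<open>t\<close>, hence exactly for every cutoff. With
  \<open>x = r t (1 - z) - z\<close>, the ingredients are \<open>(1 - z) x' = -(x + 1)\<close>,
  \<open>z (z^t)' = t z^t\<close> and \<open>r t (1 - z) = x + z\<close>. For \<open>m = 0\<close>
  the coefficient removes the term with \<open>m - 1\<close>.\<close>

lemma partial_numerator_Suc:
  assumes "r > 0"
  shows "partial_numerator r N (Suc m) = of_nat (r - 1) * zvar * partial_numerator r N m
     + of_nat r * zvar * (1 - zvar) * pderiv (partial_numerator r N m)
     + of_nat (r * m) * zvar * (partial_numerator r N m + partial_numerator r N (m - 1))"
proof -
  define x where "x t = of_nat (r * t) * (1 - zvar) - zvar" for t
  have dx: "pderiv (x t) = - of_nat (r * t) - 1" for t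
    unfolding x_def pderiv_diff pderiv_mult by (simp del: of_nat_mult)
  have pn: "partial_numerator r N k = (\<Sum>t<N. (1 - zvar) * (zvar ^ t * x t ^ k))" for k
    by (simp add: partial_numerator_def x_def sum_distrib_left)
  have "(1 - zvar) * (zvar ^ t * x t ^ Suc m) = of_nat (r - 1) * zvar * ((1 - zvar) * (zvar ^ t * x t ^ m))
     + of_nat r * zvar * (1 - zvar) * pderiv ((1 - zvar) * (zvar ^ t * x t ^ m))
     + of_nat (r * m) * zvar * ((1 - zvar) * (zvar ^ t * x t ^ m) + (1 - zvar) * (zvar ^ t * x t ^ (m - 1)))" for t
  proof -
    have r1: "of_nat (r - 1) = (of_nat r - 1 :: int poly)" using assms by simp
    have zt: "zvar * pderiv (zvar ^ t) = of_nat t * zvar ^ t"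
      by (cases t) (simp_all add: pderiv_power_Suc of_nat_poly mult_ac del: of_nat_Suc power_Suc flip: power_Suc)
    have dm: "(1 - zvar) * pderiv (x t ^ m) = - (of_nat m * (x t ^ (m - 1) * (x t + 1)))"
    proof -
      have "(1 - zvar) * pderiv (x t ^ m) = of_nat m * x t ^ (m - 1) * ((1 - zvar) * (- of_nat (r * t) - 1))"
        by (simp add: pderiv_power dx of_nat_poly mult_ac)
      also have "(1 - zvar) * (- of_nat (r * t) - 1) = - (x t + 1)"
        by (simp add: x_def algebra_simps)
      finally show ?thesis by (simp only: mult.assoc mult_minus_right)
    qed
    have xm: "of_nat m * (x t ^ (m - 1) * (x t + 1)) = of_nat m * (x t ^ m + x t ^ (m - 1))"
      by (cases m) (simp_all add: algebra_simps)
    have "of_nat r * zvar * (1 - zvar) * pderiv ((1 - zvar) * (zvar ^ t * x t ^ m))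
      = (1 - zvar) * (- of_nat r * zvar * zvar ^ t * x t ^ m
         + of_nat r * (1 - zvar) * (zvar * pderiv (zvar ^ t)) * x t ^ m
         + of_nat r * zvar * zvar ^ t * ((1 - zvar) * pderiv (x t ^ m)))"
      by (simp add: pderiv_mult pderiv_diff) (simp add: algebra_simps)
    also have "\<dots> = (1 - zvar) * zvar ^ t * (- of_nat r * zvar * x t ^ m + (of_nat (r * t) * (1 - zvar)) * x t ^ m
         - of_nat r * zvar * (of_nat m * (x t ^ m + x t ^ (m - 1))))"
      unfolding zt dm xm by (simp add: algebra_simps)
    also have "of_nat (r * t) * (1 - zvar) = x t + zvar" by (simp add: x_def)
    finally show ?thesis unfolding r1 by (simp add: algebra_simps)
  qed
  then show ?thesis
    unfolding pn by (simp add: sum.distrib sum_distrib_left pderiv_sum distrib_left)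
qed

section \<open>The permanent and the insertion of the largest letter\<close>

text \<open>The sum of \<open>z^exc\<close> over the colors that an arc \<open>i \<mapsto> j\<close> may carry in a derangement.\<close>

definition arc_weight :: "nat \<Rightarrow> nat \<Rightarrow> nat \<Rightarrow> int poly" where
  "arc_weight r i j = (if i < j then of_nat r * zvar else if j < i then of_nat r else of_nat (r - 1) * zvar)"

text \<open>The permanent of the matrix of arc weights over \<open>S\<close>. Since weights depend
  only on the order of the letters, arbitrary \<open>S\<close> lets letters be deleted without
  relabelling.\<close>

definition arc_weight_sum :: "nat \<Rightarrow> nat set \<Rightarrow> int poly" where
  "arc_weight_sum r S = (\<Sum>p | p permutes S. \<Prod>i\<in>S. arc_weight r i (p i))"

lemma sum_permutes_fixing:
  assumes "finite S" "i \<in> S"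
  shows "(\<Sum>p | p permutes S \<and> p i = i. \<Prod>j\<in>S - {i}. arc_weight r j (p j)) = arc_weight_sum r (S - {i})"
proof -
  have "{p. p permutes S \<and> p i = i} = {p. p permutes (S - {i})}"
  proof (intro Collect_eqI iffI conjI)
    fix p assume "p permutes S \<and> p i = i"
    then show "p permutes (S - {i})" by (auto intro: permutes_superset)
  next
    fix p assume p: "p permutes (S - {i})"
    then show "p permutes S" by (rule permutes_subset) auto
    show "p i = i" using p by (rule permutes_not_in) simp
  qed
  then show ?thesis by (simp add: arc_weight_sum_def)
qed

text \<open>The arc from \<open>i\<close> to \<open>p i\<close> is replaced by arcs from
  \<open>i\<close> to \<open>a\<close> and from \<open>a\<close> to \<open>p i\<close>. As
  \<open>a\<close> is largest, these are a rise of weight \<open>r z\<close> and a fall of weight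
  \<open>r\<close>.\<close>

lemma insert_into_cycle:
  assumes p: "p permutes S" and S: "finite S" and i: "i \<in> S" and a: "\<And>j. j \<in> S \<Longrightarrow> j < a"
  shows "(\<Prod>j\<in>insert a S. arc_weight r j ((transpose a (p i) \<circ> p) j))
       = of_nat r ^ 2 * zvar * (\<Prod>j\<in>S - {i}. arc_weight r j (p j))"
proof -
  have aS: "a \<notin> S" using a by blast
  have pa: "p a = a" using p aS by (rule permutes_not_in)
  have pS: "p j \<in> S" if "j \<in> S" for j using p that by (simp add: permutes_in_image)
  have ne: "p j \<noteq> p i" if "j \<noteq> i" for j using p that by (metis permutes_inj injD)
  have "(\<Prod>j\<in>insert a S. arc_weight r j ((transpose a (p i) \<circ> p) j))
     = arc_weight r a (p i) * (arc_weight r i a * (\<Prod>j\<in>S - {i}. arc_weight r j ((transpose a (p i) \<circ> p) j)))"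
    using S aS i pa by (simp add: prod.remove[of S i])
  also have "(\<Prod>j\<in>S - {i}. arc_weight r j ((transpose a (p i) \<circ> p) j)) = (\<Prod>j\<in>S - {i}. arc_weight r j (p j))"
    by (rule prod.cong) (use pS ne aS in \<open>auto simp: transpose_def\<close>)
  also have "arc_weight r a (p i) = of_nat r" using a[OF pS[OF i]] by (simp add: arc_weight_def)
  also have "arc_weight r i a = of_nat r * zvar" using a[OF i] by (simp add: arc_weight_def)
  finally show ?thesis by (simp add: power2_eq_square mult_ac)
qed

text \<open>The arc weights \<open>v = r z\<close> and \<open>v = r\<close> satisfy
  \<open>r^2 z = r z v + r z (1 - z) v'\<close>; for \<open>v = (r - 1) z\<close> a further
  \<open>r z\<close> is needed. This trades a deleted factor for the full product and one term of
  its product rule.\<close>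

lemma remove_factor:
  assumes "r > 0" "finite S" "i \<in> S"
  shows "of_nat r ^ 2 * zvar * (\<Prod>j\<in>S - {i}. arc_weight r j (p j))
     = of_nat r * zvar * (\<Prod>j\<in>S. arc_weight r j (p j))
       + of_nat r * zvar * (1 - zvar) * ((\<Prod>j\<in>S - {i}. arc_weight r j (p j)) * pderiv (arc_weight r i (p i)))
       + (if p i = i then of_nat r * zvar * (\<Prod>j\<in>S - {i}. arc_weight r j (p j)) else 0)"
proof -
  have 1: "(\<Prod>j\<in>S. arc_weight r j (p j)) = arc_weight r i (p i) * (\<Prod>j\<in>S - {i}. arc_weight r j (p j))"
    using assms by (simp add: prod.remove)
  have r1: "of_nat (r - Suc 0) = (of_nat r - 1 :: int poly)" using assms by simp
  define C where "C = (\<Prod>j\<in>S - {i}. arc_weight r j (p j))"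
  consider "i < p i" | "p i < i" | "p i = i" by linarith
  then show ?thesis unfolding 1 C_def[symmetric]
    by cases (simp_all add: arc_weight_def[of r i] pderiv_mult r1 pderiv_diff power2_eq_square algebra_simps
        del: of_nat_diff)
qed

text \<open>Either \<open>a\<close> is a fixed point or it is inserted after some \<open>i\<close>.
  Summing \<open>remove_factor\<close> over \<open>i\<close> assembles the derivative of the
  product, and the fixed points leave the permanents over \<open>S - {i}\<close>.\<close>

lemma arc_weight_sum_insert:
  assumes r: "r > 0" and S: "finite S" and a: "\<And>j. j \<in> S \<Longrightarrow> j < a"
  shows "arc_weight_sum r (insert a S) = of_nat (r - 1) * zvar * arc_weight_sum r S
     + of_nat r * zvar * (1 - zvar) * pderiv (arc_weight_sum r S)
     + of_nat (r * card S) * zvar * arc_weight_sum r S + of_nat r * zvar * (\<Sum>i\<in>S. arc_weight_sum r (S - {i}))"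
proof -
  let ?w = "\<lambda>p S. \<Prod>i\<in>S. arc_weight r i (p i)"
  have aS: "a \<notin> S" using a by blast
  have fin: "finite {p. p permutes S}" using S by (rule finite_permutations)
  have "arc_weight_sum r (insert a S)
     = (\<Sum>p | p permutes S. ?w p (insert a S))
     + (\<Sum>b\<in>S. \<Sum>p | p permutes S. ?w (transpose a b \<circ> p) (insert a S))"
    unfolding arc_weight_sum_def using S aS by (subst sum_over_permutations_insert) auto
  also have "(\<Sum>p | p permutes S. ?w p (insert a S)) = of_nat (r - 1) * zvar * arc_weight_sum r S"
    unfolding arc_weight_sum_def sum_distrib_left
  proof (rule sum.cong[OF refl], clarify)
    fix p assume "p permutes S"
    then have "p a = a" using aS by (rule permutes_not_in)
    then show "?w p (insert a S) = of_nat (r - 1) * zvar * ?w p S"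
      using S aS by (simp add: arc_weight_def)
  qed
  also have "(\<Sum>b\<in>S. \<Sum>p | p permutes S. ?w (transpose a b \<circ> p) (insert a S))
     = (\<Sum>p | p permutes S. \<Sum>b\<in>S. ?w (transpose a b \<circ> p) (insert a S))"
    by (rule sum.swap)
  also have "\<dots> = (\<Sum>p | p permutes S. \<Sum>i\<in>S. of_nat r ^ 2 * zvar * ?w p (S - {i}))"
  proof (rule sum.cong[OF refl], clarify)
    fix p assume p: "p permutes S"
    \<comment> \<open>Substituting \<open>b = p i\<close> makes \<open>i\<close> the letter that
      precedes \<open>a\<close>.\<close>
    have "(\<Sum>b\<in>S. ?w (transpose a b \<circ> p) (insert a S)) = (\<Sum>i\<in>S. ?w (transpose a (p i) \<circ> p) (insert a S))"
      by (rule sum.reindex_bij_betw[OF permutes_imp_bij[OF p], symmetric])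
    also have "\<dots> = (\<Sum>i\<in>S. of_nat r ^ 2 * zvar * ?w p (S - {i}))"
      by (rule sum.cong[OF refl], rule insert_into_cycle) (use p S a in auto)
    finally show "(\<Sum>b\<in>S. ?w (transpose a b \<circ> p) (insert a S)) = (\<Sum>i\<in>S. of_nat r ^ 2 * zvar * ?w p (S - {i}))" .
  qed
  also have "\<dots> = (\<Sum>p | p permutes S. of_nat (r * card S) * zvar * ?w p S
      + of_nat r * zvar * (1 - zvar) * pderiv (?w p S)
      + (\<Sum>i\<in>S. if p i = i then of_nat r * zvar * ?w p (S - {i}) else 0))"
  proof (rule sum.cong[OF refl], clarify)
    fix p assume "p permutes S"
    have "(\<Sum>i\<in>S. of_nat r ^ 2 * zvar * ?w p (S - {i}))
      = (\<Sum>i\<in>S. of_nat r * zvar * ?w p S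
         + of_nat r * zvar * (1 - zvar) * (?w p (S - {i}) * pderiv (arc_weight r i (p i)))
         + (if p i = i then of_nat r * zvar * ?w p (S - {i}) else 0))"
      by (rule sum.cong[OF refl]) (rule remove_factor[OF r S])
    then show "(\<Sum>i\<in>S. of_nat r ^ 2 * zvar * ?w p (S - {i})) = of_nat (r * card S) * zvar * ?w p S
      + of_nat r * zvar * (1 - zvar) * pderiv (?w p S)
      + (\<Sum>i\<in>S. if p i = i then of_nat r * zvar * ?w p (S - {i}) else 0)"
      by (simp add: sum.distrib pderiv_prod mult_ac flip: sum_distrib_left)
  qed
  also have "\<dots> = of_nat (r * card S) * zvar * arc_weight_sum r S
      + of_nat r * zvar * (1 - zvar) * pderiv (arc_weight_sum r S)
      + (\<Sum>p | p permutes S. \<Sum>i\<in>S. if p i = i then of_nat r * zvar * ?w p (S - {i}) else 0)"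
    by (simp add: arc_weight_sum_def sum.distrib pderiv_sum sum_distrib_left)
  also have "(\<Sum>p | p permutes S. \<Sum>i\<in>S. if p i = i then of_nat r * zvar * ?w p (S - {i}) else 0)
      = (\<Sum>i\<in>S. \<Sum>p | p permutes S. if p i = i then of_nat r * zvar * ?w p (S - {i}) else 0)"
    by (rule sum.swap)
  also have "\<dots> = (\<Sum>i\<in>S. of_nat r * zvar * arc_weight_sum r (S - {i}))"
  proof (rule sum.cong[OF refl])
    fix i assume i: "i \<in> S"
    have "(\<Sum>p | p permutes S. if p i = i then of_nat r * zvar * ?w p (S - {i}) else 0)
      = (\<Sum>p | p permutes S \<and> p i = i. of_nat r * zvar * ?w p (S - {i}))"
      using fin by (simp add: sum.inter_filter[symmetric])
    then show "(\<Sum>p | p permutes S. if p i = i then of_nat r * zvar * ?w p (S - {i}) else 0) = of_nat r * zvar * arc_weight_sum r (S - {i})"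
      using sum_permutes_fixing[OF S i, of r] by (simp flip: sum_distrib_left)
  qed
  finally show ?thesis by (simp add: sum_distrib_left add_ac)
qed

text \<open>Deleting the largest letter yields the recurrence of
  \<open>partial_numerator_Suc\<close>, because all sets \<open>T - {i}\<close> have the same size
  and hence congruent permanents. The induction is strong since the recurrence reaches two sizes
  back.\<close>

lemma arc_weight_sum_partial_numerator:
  assumes "r > 0" "finite S"
  shows "zvar ^ N dvd arc_weight_sum r S - partial_numerator r N (card S)"
  using assms(2)
proof (induction "card S" arbitrary: S rule: less_induct)
  case less
  show ?case
  proof (cases "S = {}")
    case True
    then show ?thesis using geometric_dvd[of N] by (simp add: arc_weight_sum_def partial_numerator_def)
  next
    case False
    define a T where "a = Max S" and "T = S - {a}"
    have aS: "a \<in> S" using False less.prems by (simp add: a_def)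
    then have S: "S = insert a T" by (auto simp: T_def)
    have T: "finite T" using less.prems by (simp add: T_def)
    have lt: "j < a" if "j \<in> T" for j
      using that less.prems Max_ge[of S j] unfolding T_def a_def[symmetric] by force
    have c: "card S = Suc (card T)" using S T lt by (metis card_insert_disjoint less_irrefl)
    let ?pn = "partial_numerator r N"
    have 1: "zvar ^ N dvd arc_weight_sum r T - ?pn (card T)"
      using less.hyps[of T] c T by simp
    have 2: "zvar ^ N dvd arc_weight_sum r (T - {i}) - ?pn (card T - 1)" if "i \<in> T" for i
      using less.hyps[of "T - {i}"] c T that by (simp add: card_Diff_singleton card_gt_0_iff)
    have 3: "zvar ^ N dvd (\<Sum>i\<in>T. arc_weight_sum r (T - {i}) - ?pn (card T - 1))"
      by (rule dvd_sum) (rule 2)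
    have 4: "zvar ^ N dvd zvar * pderiv (arc_weight_sum r T - ?pn (card T))"
      by (rule zvar_power_dvd_pderiv[OF 1])
    have 5: "arc_weight_sum r S = of_nat (r - 1) * zvar * arc_weight_sum r T
       + of_nat r * zvar * (1 - zvar) * pderiv (arc_weight_sum r T)
       + of_nat (r * card T) * zvar * arc_weight_sum r T + of_nat r * zvar * (\<Sum>i\<in>T. arc_weight_sum r (T - {i}))"
      unfolding S using assms(1) T lt by (rule arc_weight_sum_insert)
    have "arc_weight_sum r S - ?pn (card S)
      = (of_nat (r - 1) * zvar + of_nat (r * card T) * zvar) * (arc_weight_sum r T - ?pn (card T))
      + of_nat r * (1 - zvar) * (zvar * pderiv (arc_weight_sum r T - ?pn (card T)))
      + of_nat r * zvar * (\<Sum>i\<in>T. arc_weight_sum r (T - {i}) - ?pn (card T - 1))"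
      unfolding c partial_numerator_Suc[OF assms(1)] 5
      by (simp add: pderiv_diff sum_subtractf algebra_simps)
    also have "zvar ^ N dvd \<dots>"
      by (intro dvd_add dvd_mult[OF 1] dvd_mult[OF 3] dvd_mult[OF 4])
    finally show ?thesis .
  qed
qed

text \<open>The letters are colored independently, so for a fixed permutation the sum over colorings
  of a product is the product of the sums over colors.\<close>

lemma d_nr_eq_arc_weight_sum:
  assumes "r > 0"
  shows "d_nr n r = arc_weight_sum r {1..n}"
proof -
  let ?I = "{1..n}"
  define C where "C = {c :: nat \<Rightarrow> nat. (\<forall>i\<in>?I. c i < r) \<and> (\<forall>i. i \<notin> ?I \<longrightarrow> c i = 0)}"
  \<comment> \<open>Weight 0 for a fixed point of color 0 removes the non-derangements, so all
    colorings may be summed.\<close>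
  define v :: "nat \<Rightarrow> nat \<Rightarrow> nat \<Rightarrow> int poly" where
    "v i j c = (if i < j \<or> j = i \<and> 0 < c then zvar else if j = i then 0 else 1)" for i j c
  have C: "(\<Sum>c\<in>C. \<Prod>i\<in>?I. f i (c i)) = (\<Prod>i\<in>?I. \<Sum>c<r. f i c)" for f :: "nat \<Rightarrow> nat \<Rightarrow> int poly"
  proof -
    have "(\<Sum>c\<in>C. \<Prod>i\<in>?I. f i (c i)) = (\<Sum>c\<in>PiE ?I (\<lambda>_. {..<r}). \<Prod>i\<in>?I. f i (c i))"
      by (rule sum.reindex_bij_witness[of _ "\<lambda>c i. if i \<in> ?I then c i else 0" "\<lambda>c. restrict c ?I"])
        (auto simp: C_def PiE_iff extensional_def fun_eq_iff restrict_def intro!: prod.cong)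
    then show ?thesis by (simp add: prod_sum_PiE)
  qed
  have finC: "finite C"
  proof (rule finite_subset)
    show "C \<subseteq> (\<lambda>c i. if i \<in> ?I then c i else 0) ` (PiE ?I (\<lambda>_. {..<r}))"
    proof
      fix c assume "c \<in> C"
      then show "c \<in> (\<lambda>c i. if i \<in> ?I then c i else 0) ` (PiE ?I (\<lambda>_. {..<r}))"
        by (intro image_eqI[of _ _ "restrict c ?I"]) (auto simp: C_def fun_eq_iff)
    qed
  qed (auto intro: finite_PiE)
  have finp: "finite {p. p permutes ?I}" by (rule finite_permutations) simp
  have v_sum: "(\<Sum>c<r. v i j c) = arc_weight r i j" for i j
  proof -
    obtain k where k: "r = Suc k" using assms gr0_implies_Suc by blast
    show ?thesis unfolding v_def arc_weight_def k
      by (simp add: sum.lessThan_Suc_shift algebra_simps del: sum.lessThan_Suc)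
  qed
  have v_prod: "(\<Prod>i\<in>?I. v i (p i) (c i))
      = (if (p, c) \<in> colored_derangements n r then monom 1 (exc n (p, c)) else 0)"
    if "p permutes ?I" "c \<in> C" for p c
  proof (cases "\<exists>i\<in>?I. p i = i \<and> c i = 0")
    case True
    then have "\<exists>i\<in>?I. v i (p i) (c i) = 0" by (force simp: v_def)
    then have "(\<Prod>i\<in>?I. v i (p i) (c i)) = 0" by (intro prod_zero) auto
    then show ?thesis using True by (auto simp: colored_derangements_def)
  next
    case False
    then have "(\<Prod>i\<in>?I. v i (p i) (c i)) = (\<Prod>i\<in>?I. if i < p i \<or> p i = i \<and> 0 < c i then zvar else 1)"
      by (intro prod.cong) (auto simp: v_def)
    also have "\<dots> = (\<Prod>i | i \<in> ?I \<and> (i < p i \<or> p i = i \<and> 0 < c i). zvar)"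
      by (rule prod.inter_filter[symmetric]) simp
    also have "\<dots> = monom 1 (exc n (p, c))"
      by (simp add: exc_def monom_1_eq_zvar_power)
    finally show ?thesis using False that by (simp add: colored_derangements_def colored_perms_def C_def)
  qed
  have sub: "colored_derangements n r \<subseteq> {p. p permutes ?I} \<times> C"
    by (auto simp: colored_derangements_def colored_perms_def C_def)
  have "d_nr n r = (\<Sum>x\<in>{p. p permutes ?I} \<times> C.
      if x \<in> colored_derangements n r then monom 1 (exc n x) else 0)"
    unfolding d_nr_def using sub finC finp
    by (intro sum.mono_neutral_cong_left) auto
  also have "\<dots> = (\<Sum>p | p permutes ?I. \<Sum>c\<in>C. \<Prod>i\<in>?I. v i (p i) (c i))"
    unfolding sum.cartesian_product
    by (rule sum.cong) (use v_prod in \<open>simp_all add: split_beta mem_Times_iff\<close>)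
  also have "\<dots> = arc_weight_sum r ?I"
    unfolding arc_weight_sum_def
  proof (rule sum.cong[OF refl])
    fix p
    show "(\<Sum>c\<in>C. \<Prod>i\<in>?I. v i (p i) (c i)) = (\<Prod>i\<in>?I. arc_weight r i (p i))"
      using C[of "\<lambda>i. v i (p i)"] by (simp only: v_sum)
  qed
  finally show ?thesis .
qed

section \<open>From congruences modulo all powers of z to equality\<close>

lemma zvar_power_dvd_imp_zero:
  assumes "\<And>N. zvar ^ N dvd p"
  shows "p = 0"
proof (rule ccontr)
  assume "p \<noteq> 0"
  moreover have "degree (zvar ^ Suc (degree p)) = Suc (degree p)"
    by (metis degree_monom_eq monom_1_eq_zvar_power one_neq_zero)
  ultimately show False
    using dvd_imp_degree_le[OF assms[of "Suc (degree p)"]] by simp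
qed

theorem theorem4p9:
  fixes n r :: nat
  assumes "n > 0" and "r > 0"
  shows "d_t (map (\<lambda>k. k * r) [2..<n+1]) + d_t (map (\<lambda>k. k * r) [1..<n+1]) = d_nr n r"
proof -
  let ?L = "d_t (map (\<lambda>k. k * r) [2..<n+1]) + d_t (map (\<lambda>k. k * r) [1..<n+1])"
  \<comment> \<open>The shorter sequence starts at residue 0 only and the longer one at all other
    residues; together they start freely.\<close>
  have first: "(\<lambda>i::nat. (if i = 0 then 1 else 0) + (if i = 0 then 0 else 1)) = (\<lambda>_. 1 :: int poly)"
    by auto
  have L: "?L = residue_sum (\<lambda>k. Suc k * r) (\<lambda>_. 1) n 0"
    unfolding d_t_multiples_from_1[OF assms] d_t_multiples_from_2[OF assms] residue_sum_add[symmetric] first ..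
  have "zvar ^ N dvd ?L - d_nr n r" for N
  proof -
    have "zvar ^ N dvd ?L - partial_numerator r N n"
      unfolding L using assms(2) by (rule residue_sum_partial_numerator)
    moreover have "zvar ^ N dvd d_nr n r - partial_numerator r N n"
      using arc_weight_sum_partial_numerator[OF assms(2), of "{1..n}" N] d_nr_eq_arc_weight_sum[OF assms(2)] by simp
    ultimately have "zvar ^ N dvd (?L - partial_numerator r N n) - (d_nr n r - partial_numerator r N n)"
      by (rule dvd_diff)
    then show ?thesis by (simp only: diff_diff_eq2 diff_add_cancel)
  qed
  then have "?L - d_nr n r = 0" by (rule zvar_power_dvd_imp_zero)
  then show ?thesis by (simp only: right_minus_eq)
qed

end
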